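(* For $(\underline{s}_1,\underline{s}_2,\overline{s}_1,\overline{s}_2)\in\mathbb{D}$ and $i\in\{-1,0,1\}$ we have $$\mathbf{t}^{(-1,i)}(\underline{s}_1,\underline{s}_2,\overline{s}_1,\overline{s}_2)=\mathbf{t}^{(-1,i)}(\underline{s}_1,\underline{s}_2,\underline{s}_1,\overline{s}_2).$$
   Context: $\mathbb{R}_+=[0,\infty)$. $\mathbb{D}=\{(\underline{s}_1,\underline{s}_2,\overline{s}_1,\overline{s}_2)\in\mathbb{R}_+^2\times\mathbb{R}_+^2:\ 0<\underline{s}_1\le\overline{s}_1,\ 0<\underline{s}_2\le\overline{s}_2\}$. For $(x,y_1,y_2)\in\mathbb{R}_+\times\mathbb{R}_+^2$ and prices in $\mathbb{D}$, $\mathbb{A}(x,y_1,y_2,\underline{s}_1,\underline{s}_2,\overline{s}_1,\overline{s}_2)$ is the set of all $(l_1,l_2,m_1,m_2)\in\mathbb{R}_+^2\times\mathbb{R}_+^2$ with $0\le x+\underline{s}_1m_1+\underline{s}_2m_2-\overline{s}_1l_1-\overline{s}_2l_2$, $0\le y_i-m_i+l_i$ and $m_i\le y_i$ for $i=1,2$. $g:\mathbb{R}_+\times\mathbb{R}_+^2\to\mathbb{R}\cup\{-\infty\}$ is a fixed strictly concave function, strictly increasing with respect to each variable; $$\varphi(x,y_1,y_2,\underline{s}_1,\underline{s}_2,\overline{s}_1,\overline{s}_2,l_1,l_2,m_1,m_2)=g\big(x+\underline{s}_1m_1+\underline{s}_2m_2-\overline{s}_1l_1-\overline{s}_2l_2,\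 y_1-m_1+l_1,\ y_2-m_2+l_2\big),$$ and $\Phi(x,y_1,y_2,\underline{s}_1,\underline{s}_2,\overline{s}_1,\overline{s}_2)$ is the supremum of $\varphi$ over $(l_1,l_2,m_1,m_2)\in\mathbb{A}(x,y_1,y_2,\underline{s}_1,\underline{s}_2,\overline{s}_1,\overline{s}_2)$. For $(i_1,i_2)\in\{-1,0,1\}^2$, $\mathbb{A}^{(i_1,i_2)}(x,y_1,y_2,\underline{s}_1,\underline{s}_2,\overline{s}_1,\overline{s}_2)$ is the set of $(l_1,l_2,m_1,m_2)\in\mathbb{A}(x,y_1,y_2,\underline{s}_1,\underline{s}_2,\overline{s}_1,\overline{s}_2)$ with $i_1=\operatorname{sgn}(l_1-m_1)$, $i_2=\operatorname{sgn}(l_2-m_2)$, $l_1m_1+l_2m_2=0$ (with $\operatorname{sgn}\in\{-1,0,1\}$). The trading set $\mathbf{t}^{(i_1,i_2)}(\underline{s}_1,\underline{s}_2,\overline{s}_1,\overline{s}_2)$ is the set of $(x,y_1,y_2)\in\mathbb{R}_+\times\mathbb{R}_+^2$ for which there is $(l_1,l_2,m_1,m_2)\in\mathbb{A}^{(i_1,i_2)}(x,y_1,y_2,\underline{s}_1,\underline{s}_2,\overline{s}_1,\overline{s}_2)$ with $\Phi(x,y_1,y_2,\underline{s}_1,\underline{s}_2,\overline{s}_1,\overline{s}_2)=\varphi(x,y_1,y_2,\underline{s}_1,\underline{s}_2,\overline{s}_1,\overline{s}_2,l_1,l_2,m_1,m_2)$. Arguments are always ordered (bid 1, bid 2, ask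 1, ask 2). *)

theory Defs
  imports "HOL-Analysis.Analysis"
begin

definition positions :: "(real \<times> real \<times> real) set" where
  "positions = {0..} \<times> {0..} \<times> {0..}"

text \<open>Prices are always ordered (bid 1, bid 2, ask 1, ask 2).\<close>

definition prices :: "(real \<times> real \<times> real \<times> real) set" where
  "prices = {(b1, b2, a1, a2). 0 < b1 \<and> b1 \<le> a1 \<and> 0 < b2 \<and> b2 \<le> a2}"

text \<open>Strict concavity of an extended-real function. It is used for functions that do not
  take the value \<open>\<infinity>\<close> on \<open>S\<close>, so \<open>\<infinity> - \<infinity>\<close> does not occur in the sum.\<close>

definition strictly_concave_on :: "'a::real_vector set \<Rightarrow> ('a \<Rightarrow> ereal) \<Rightarrow> bool" where
  "strictly_concave_on S f \<longleftrightarrow> convex S \<and>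
     (\<forall>p\<in>S. \<forall>q\<in>S. \<forall>t. p \<noteq> q \<longrightarrow> 0 < t \<longrightarrow> t < 1 \<longrightarrow>
        ereal (1 - t) * f p + ereal t * f q < f ((1 - t) *\<^sub>R p + t *\<^sub>R q))"

definition strictly_increasing_each :: "(real \<times> real \<times> real \<Rightarrow> ereal) \<Rightarrow> bool" where
  "strictly_increasing_each g \<longleftrightarrow>
     (\<forall>y1\<ge>0. \<forall>y2\<ge>0. strict_mono_on {0..} (\<lambda>x. g (x, y1, y2))) \<and>
     (\<forall>x\<ge>0. \<forall>y2\<ge>0. strict_mono_on {0..} (\<lambda>y1. g (x, y1, y2))) \<and>
     (\<forall>x\<ge>0. \<forall>y1\<ge>0. strict_mono_on {0..} (\<lambda>y2. g (x, y1, y2)))"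

text \<open>Strategies are ordered \<open>(l1, l2, m1, m2)\<close>: amounts bought, then amounts sold.\<close>

definition admissible ::
  "real \<Rightarrow> real \<Rightarrow> real \<Rightarrow> real \<Rightarrow> real \<Rightarrow> real \<Rightarrow> real \<Rightarrow> (real \<times> real \<times> real \<times> real) set" where
  "admissible x y1 y2 b1 b2 a1 a2 =
     {(l1, l2, m1, m2). 0 \<le> l1 \<and> 0 \<le> l2 \<and> 0 \<le> m1 \<and> 0 \<le> m2 \<and>
        0 \<le> x + b1 * m1 + b2 * m2 - a1 * l1 - a2 * l2 \<and>
        0 \<le> y1 - m1 + l1 \<and> 0 \<le> y2 - m2 + l2 \<and> m1 \<le> y1 \<and> m2 \<le> y2}"

definition payoff ::
  "(real \<times> real \<times> real \<Rightarrow> ereal) \<Rightarrow> real \<Rightarrow> real \<Rightarrow> real \<Rightarrow> real \<Rightarrow> real \<Rightarrow> real \<Rightarrow> real \<Rightarrow>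
     real \<Rightarrow> real \<Rightarrow> real \<Rightarrow> real \<Rightarrow> ereal" where
  "payoff g x y1 y2 b1 b2 a1 a2 l1 l2 m1 m2 =
     g (x + b1 * m1 + b2 * m2 - a1 * l1 - a2 * l2, y1 - m1 + l1, y2 - m2 + l2)"

definition opt_payoff ::
  "(real \<times> real \<times> real \<Rightarrow> ereal) \<Rightarrow> real \<Rightarrow> real \<Rightarrow> real \<Rightarrow> real \<Rightarrow> real \<Rightarrow> real \<Rightarrow> real \<Rightarrow> ereal" where
  "opt_payoff g x y1 y2 b1 b2 a1 a2 =
     (SUP (l1, l2, m1, m2) \<in> admissible x y1 y2 b1 b2 a1 a2.
        payoff g x y1 y2 b1 b2 a1 a2 l1 l2 m1 m2)"

definition admissible_dir ::
  "int \<Rightarrow> int \<Rightarrow> real \<Rightarrow> real \<Rightarrow> real \<Rightarrow> real \<Rightarrow> real \<Rightarrow> real \<Rightarrow> real \<Rightarrow>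
     (real \<times> real \<times> real \<times> real) set" where
  "admissible_dir i1 i2 x y1 y2 b1 b2 a1 a2 =
     {(l1, l2, m1, m2). (l1, l2, m1, m2) \<in> admissible x y1 y2 b1 b2 a1 a2 \<and>
        of_int i1 = sgn (l1 - m1) \<and> of_int i2 = sgn (l2 - m2) \<and> l1 * m1 + l2 * m2 = 0}"

definition trading_set ::
  "(real \<times> real \<times> real \<Rightarrow> ereal) \<Rightarrow> int \<Rightarrow> int \<Rightarrow> real \<Rightarrow> real \<Rightarrow> real \<Rightarrow> real \<Rightarrow>
     (real \<times> real \<times> real) set" where
  "trading_set g i1 i2 b1 b2 a1 a2 =
     {(x, y1, y2). (x, y1, y2) \<in> positions \<and>
        (\<exists>(l1, l2, m1, m2) \<in> admissible_dir i1 i2 x y1 y2 b1 b2 a1 a2.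
           opt_payoff g x y1 y2 b1 b2 a1 a2 = payoff g x y1 y2 b1 b2 a1 a2 l1 l2 m1 m2)}"

end

theory Submission
  imports Defs
begin

text \<open>
  An investor who sells asset 1 never pays its ask price, so a selling strategy is available, with
  the same payoff, both at the ask price \<open>a1\<close> and at the lower ask price \<open>b1\<close>. The trading sets
  therefore agree once such a strategy is optimal at one of these ask prices exactly if it is optimal
  at the other.

  From \<open>b1\<close> to \<open>a1\<close> this is monotonicity: a higher ask price leaves less cash after the same
  trades, so the optimal value can only fall (\<open>opt_payoff_antimono_ask\<close>), while the payoff of
  the seller stays what it was.

  From \<open>a1\<close> to \<open>b1\<close> it comes from concavity (\<open>seller_optimal_at_bid\<close>). Without a spread only
  the net sale of asset 1 matters, and the position reached is affine in it. If some strategy were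
  better than the seller at the ask price \<open>b1\<close>, then so would be every strict mixture of the two.
  A mixture close enough to the seller still does not buy asset 1 on balance, so it is also available
  at the ask price \<open>a1\<close> (\<open>better_seller\<close>), where the seller was optimal.
\<close>

lemma payoff_le_opt_payoff:
  assumes "(l1, l2, m1, m2) \<in> admissible x y1 y2 b1 b2 a1 a2"
  shows "payoff g x y1 y2 b1 b2 a1 a2 l1 l2 m1 m2 \<le> opt_payoff g x y1 y2 b1 b2 a1 a2"
  unfolding opt_payoff_def using SUP_upper[OF assms, of "\<lambda>(l1, l2, m1, m2). payoff g x y1 y2 b1 b2 a1 a2 l1 l2 m1 m2"]
  by simp

lemma opt_payoff_le:
  assumes "\<And>l1 l2 m1 m2. (l1, l2, m1, m2) \<in> admissible x y1 y2 b1 b2 a1 a2 \<Longrightarrow>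
             payoff g x y1 y2 b1 b2 a1 a2 l1 l2 m1 m2 \<le> c"
  shows "opt_payoff g x y1 y2 b1 b2 a1 a2 \<le> c"
  unfolding opt_payoff_def using assms by (auto intro!: SUP_least)

lemma opt_payoff_antimono_ask:
  assumes g: "strictly_increasing_each g" and "a \<le> a1"
  shows "opt_payoff g x y1 y2 b1 b2 a1 a2 \<le> opt_payoff g x y1 y2 b1 b2 a a2"
proof (rule opt_payoff_le)
  fix l1 l2 m1 m2
  assume adm: "(l1, l2, m1, m2) \<in> admissible x y1 y2 b1 b2 a1 a2"
  have le: "a * l1 \<le> a1 * l1"
    using adm \<open>a \<le> a1\<close> by (auto simp: admissible_def intro: mult_right_mono)
  have "strict_mono_on {0..} (\<lambda>x. g (x, y1 - m1 + l1, y2 - m2 + l2))"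
    using g adm by (auto simp: strictly_increasing_each_def admissible_def)
  from strict_mono_on_leD[OF this]
  have "payoff g x y1 y2 b1 b2 a1 a2 l1 l2 m1 m2 \<le> payoff g x y1 y2 b1 b2 a a2 l1 l2 m1 m2"
    using adm le unfolding payoff_def by (auto simp: admissible_def)
  also have "\<dots> \<le> opt_payoff g x y1 y2 b1 b2 a a2"
    by (rule payoff_le_opt_payoff) (use adm le in \<open>auto simp: admissible_def\<close>)
  finally show "payoff g x y1 y2 b1 b2 a1 a2 l1 l2 m1 m2 \<le> opt_payoff g x y1 y2 b1 b2 a a2" .
qed

text \<open>The complementarity condition excludes buying and selling the same asset at once, as both
  products in it are nonnegative.\<close>

lemma admissible_dir_sell_iff:
  "(l1, l2, m1, m2) \<in> admissible_dir (-1) i x y1 y2 b1 b2 a1 a2 \<longleftrightarrow>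
     (l1, l2, m1, m2) \<in> admissible x y1 y2 b1 b2 a1 a2 \<and> l1 = 0 \<and> 0 < m1 \<and>
     of_int i = sgn (l2 - m2) \<and> l2 * m2 = 0"
proof -
  have "l1 = 0 \<and> 0 < m1 \<and> l2 * m2 = 0"
    if "-1 = sgn (l1 - m1)" "l1 * m1 + l2 * m2 = 0" "0 \<le> l1" "0 \<le> l2" "0 \<le> m1" "0 \<le> m2"
  proof -
    have "l1 < m1"
      using that(1) by (simp add: sgn_if split: if_splits)
    moreover have "l1 * m1 = 0 \<and> l2 * m2 = 0"
      using that by (simp add: add_nonneg_eq_0_iff)
    ultimately show ?thesis
      using that(3) by auto
  qed
  then show ?thesis
    by (auto simp: admissible_dir_def admissible_def)
qed

lemma admissible_sell_cong:
  "(0, l2, m1, m2) \<in> admissible x y1 y2 b1 b2 a1 a2 \<longleftrightarrow> (0, l2, m1, m2) \<in> admissible x y1 y2 b1 b2 a a2"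
  by (simp add: admissible_def)

lemma payoff_sell_cong:
  "payoff g x y1 y2 b1 b2 a1 a2 0 l2 m1 m2 = payoff g x y1 y2 b1 b2 a a2 0 l2 m1 m2"
  by (simp add: payoff_def)

text \<open>Strict concavity is what makes this true even where \<open>g p = -\<infinity>\<close>: every strict
  mixture then has a value above \<open>-\<infinity>\<close>.\<close>

lemma strictly_concave_on_less_mixture:
  assumes "strictly_concave_on S f" "p \<in> S" "q \<in> S" "f q \<noteq> \<infinity>" "f p < f q" "0 < t" "t < 1"
  shows "f p < f ((1 - t) *\<^sub>R p + t *\<^sub>R q)"
proof -
  have "f p \<le> ereal (1 - t) * f p + ereal t * f q"
  proof (cases "f p")
    case (real r)
    then obtain s where s: "f q = ereal s" "r < s"
      using assms(4,5) by (cases "f q") auto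
    have "t * r \<le> t * s"
      using s(2) \<open>0 < t\<close> by simp
    then show ?thesis
      by (simp add: real s(1) algebra_simps)
  qed (use assms(4,5) in auto)
  also have "\<dots> < f ((1 - t) *\<^sub>R p + t *\<^sub>R q)"
    using assms unfolding strictly_concave_on_def by fast
  finally show ?thesis .
qed

text \<open>Mixing a seller with a better strategy gives a better seller: replacing the trades in asset 1 by their net sale does not
  change the position reached when bid and ask coincide, so the mixture can be taken of net sales,
  and for a small weight of the better strategy it does not buy.\<close>

lemma better_seller:
  assumes fin: "\<forall>p \<in> positions. g p \<noteq> \<infinity>"
    and conc: "strictly_concave_on positions g"
    and sell: "(0, l2, m1, m2) \<in> admissible x y1 y2 b1 b2 b1 a2" "0 < m1"
    and other: "(l1', l2', m1', m2') \<in> admissible x y1 y2 b1 b2 b1 a2"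
    and better: "payoff g x y1 y2 b1 b2 b1 a2 0 l2 m1 m2 < payoff g x y1 y2 b1 b2 b1 a2 l1' l2' m1' m2'"
  obtains l2'' m1'' m2'' where "(0, l2'', m1'', m2'') \<in> admissible x y1 y2 b1 b2 b1 a2"
    and "payoff g x y1 y2 b1 b2 b1 a2 0 l2 m1 m2 < payoff g x y1 y2 b1 b2 b1 a2 0 l2'' m1'' m2''"
proof -
  define n where "n = m1' - l1'"
  define p where "p = (x + b1 * m1 + b2 * m2 - a2 * l2, y1 - m1, y2 - m2 + l2)"
  define q where "q = (x + b1 * n + b2 * m2' - a2 * l2', y1 - n, y2 - m2' + l2')"
  have p: "g p = payoff g x y1 y2 b1 b2 b1 a2 0 l2 m1 m2" "p \<in> positions"
    using sell by (auto simp: payoff_def p_def positions_def admissible_def)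
  have q: "g q = payoff g x y1 y2 b1 b2 b1 a2 l1' l2' m1' m2'" "q \<in> positions"
    using other by (auto simp: payoff_def q_def n_def positions_def admissible_def algebra_simps)
  \<comment> \<open>The weight of the better strategy is so small that the net sale stays nonnegative even if
      that strategy buys.\<close>
  define t where "t = m1 / (m1 + \<bar>n\<bar> + 1)"
  have t: "0 < t" "t < 1"
    using \<open>0 < m1\<close> by (auto simp: t_def field_simps)
  define mix where "mix u v = (1 - t) * u + t * v" for u v
  have mix_nonneg: "0 \<le> mix u v" if "0 \<le> u" "0 \<le> v" for u v
    using that t by (simp add: mix_def)
  have "t * \<bar>n\<bar> \<le> (1 - t) * m1"
    using \<open>0 < m1\<close> by (simp add: t_def field_simps)
  moreover have "- (t * \<bar>n\<bar>) \<le> t * n"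
    using mult_left_mono[of "- \<bar>n\<bar>" n t] t by simp
  ultimately have net: "0 \<le> mix m1 n"
    unfolding mix_def by linarith
  have eq: "(1 - t) *\<^sub>R p + t *\<^sub>R q =
      (x + b1 * mix m1 n + b2 * mix m2 m2' - a2 * mix l2 l2', y1 - mix m1 n, y2 - mix m2 m2' + mix l2 l2')"
    by (simp add: p_def q_def mix_def algebra_simps)
  have "(1 - t) *\<^sub>R p + t *\<^sub>R q \<in> positions"
    using conc p(2) q(2) t by (auto simp: strictly_concave_on_def convex_alt)
  moreover have "0 \<le> mix (y2 - m2) (y2 - m2')"
    using sell other by (intro mix_nonneg) (auto simp: admissible_def)
  then have "mix m2 m2' \<le> y2"
    by (simp add: mix_def algebra_simps)
  moreover have "0 \<le> mix l2 l2'" "0 \<le> mix m2 m2'"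
    using sell other by (auto intro!: mix_nonneg simp: admissible_def)
  ultimately have adm: "(0, mix l2 l2', mix m1 n, mix m2 m2') \<in> admissible x y1 y2 b1 b2 b1 a2"
    using net unfolding eq by (simp add: positions_def admissible_def)
  have "g p < g ((1 - t) *\<^sub>R p + t *\<^sub>R q)"
    using better p q fin t by (intro strictly_concave_on_less_mixture[OF conc]) auto
  then have "payoff g x y1 y2 b1 b2 b1 a2 0 l2 m1 m2
      < payoff g x y1 y2 b1 b2 b1 a2 0 (mix l2 l2') (mix m1 n) (mix m2 m2')"
    unfolding p(1) eq by (simp add: payoff_def)
  with adm show ?thesis
    by (rule that)
qed

lemma seller_optimal_at_bid:
  assumes fin: "\<forall>p \<in> positions. g p \<noteq> \<infinity>"
    and conc: "strictly_concave_on positions g"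
    and sell: "(0, l2, m1, m2) \<in> admissible x y1 y2 b1 b2 a1 a2" "0 < m1"
    and opt: "opt_payoff g x y1 y2 b1 b2 a1 a2 = payoff g x y1 y2 b1 b2 a1 a2 0 l2 m1 m2"
  shows "opt_payoff g x y1 y2 b1 b2 b1 a2 = payoff g x y1 y2 b1 b2 b1 a2 0 l2 m1 m2"
proof (rule antisym)
  have sell': "(0, l2, m1, m2) \<in> admissible x y1 y2 b1 b2 b1 a2"
    using sell(1) admissible_sell_cong by blast
  then show "payoff g x y1 y2 b1 b2 b1 a2 0 l2 m1 m2 \<le> opt_payoff g x y1 y2 b1 b2 b1 a2"
    by (rule payoff_le_opt_payoff)
  show "opt_payoff g x y1 y2 b1 b2 b1 a2 \<le> payoff g x y1 y2 b1 b2 b1 a2 0 l2 m1 m2"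
  proof (rule opt_payoff_le, rule ccontr)
    fix l1' l2' m1' m2'
    assume other: "(l1', l2', m1', m2') \<in> admissible x y1 y2 b1 b2 b1 a2"
      and "\<not> payoff g x y1 y2 b1 b2 b1 a2 l1' l2' m1' m2' \<le> payoff g x y1 y2 b1 b2 b1 a2 0 l2 m1 m2"
    then have "payoff g x y1 y2 b1 b2 b1 a2 0 l2 m1 m2 < payoff g x y1 y2 b1 b2 b1 a2 l1' l2' m1' m2'"
      by simp
    from better_seller[OF fin conc sell' sell(2) other this]
    obtain l2'' m1'' m2'' where adm: "(0, l2'', m1'', m2'') \<in> admissible x y1 y2 b1 b2 b1 a2"
      and less: "payoff g x y1 y2 b1 b2 b1 a2 0 l2 m1 m2 < payoff g x y1 y2 b1 b2 b1 a2 0 l2'' m1'' m2''"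
      by blast
    have "payoff g x y1 y2 b1 b2 a1 a2 0 l2'' m1'' m2'' \<le> opt_payoff g x y1 y2 b1 b2 a1 a2"
      using adm admissible_sell_cong by (blast intro: payoff_le_opt_payoff)
    with less show False
      unfolding opt payoff_sell_cong[of g x y1 y2 b1 b2 a1 a2 _ _ _ b1] by simp
  qed
qed

theorem corollary6p2:
  fixes g :: "real \<times> real \<times> real \<Rightarrow> ereal"
    and b1 b2 a1 a2 :: real and i :: int
  assumes "\<forall>p \<in> positions. g p \<noteq> \<infinity>"
    and "strictly_concave_on positions g"
    and "strictly_increasing_each g"
    and "(b1, b2, a1, a2) \<in> prices"
    and "i \<in> {-1, 0, 1}"
  shows "trading_set g (-1) i b1 b2 a1 a2 = trading_set g (-1) i b1 b2 b1 a2"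
proof -
  have opt_iff: "opt_payoff g x y1 y2 b1 b2 a1 a2 = payoff g x y1 y2 b1 b2 a1 a2 0 l2 m1 m2 \<longleftrightarrow>
      opt_payoff g x y1 y2 b1 b2 b1 a2 = payoff g x y1 y2 b1 b2 b1 a2 0 l2 m1 m2" (is "?A \<longleftrightarrow> ?B")
    if sell: "(0, l2, m1, m2) \<in> admissible x y1 y2 b1 b2 a1 a2" "0 < m1" for x y1 y2 l2 m1 m2
  proof
    assume ?A
    then show ?B
      using seller_optimal_at_bid[OF assms(1,2) sell] by blast
  next
    assume ?B
    moreover have "b1 \<le> a1"
      using assms(4) by (simp add: prices_def)
    ultimately have "opt_payoff g x y1 y2 b1 b2 a1 a2 \<le> payoff g x y1 y2 b1 b2 a1 a2 0 l2 m1 m2"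
      using opt_payoff_antimono_ask[OF assms(3), of b1 a1 x y1 y2 b1 b2 a2]
        payoff_sell_cong[of g x y1 y2 b1 b2 a1 a2 l2 m1 m2 b1] by simp
    then show ?A
      using payoff_le_opt_payoff[OF sell(1), of g] by (rule antisym)
  qed
  have "(\<exists>(l1, l2, m1, m2) \<in> admissible_dir (-1) i x y1 y2 b1 b2 a1 a2.
          opt_payoff g x y1 y2 b1 b2 a1 a2 = payoff g x y1 y2 b1 b2 a1 a2 l1 l2 m1 m2) \<longleftrightarrow>
        (\<exists>(l1, l2, m1, m2) \<in> admissible_dir (-1) i x y1 y2 b1 b2 b1 a2.
          opt_payoff g x y1 y2 b1 b2 b1 a2 = payoff g x y1 y2 b1 b2 b1 a2 l1 l2 m1 m2)" for x y1 y2
    unfolding Bex_def split_paired_Ex case_prod_conv admissible_dir_sell_iff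
    using opt_iff admissible_sell_cong[of _ _ _ x y1 y2 b1 b2 a1 a2 b1] by (intro iff_exI) auto
  then show ?thesis
    unfolding trading_set_def by simp
qed

end
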